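(* Let $n\geqslant 1$ be an integer and let $E(\mathcal{PIO}_n^-)$ be the set of all idempotents of the monoid $\mathcal{PIO}_n^-$. Then $$\lvert E(\mathcal{PIO}_n^-)\rvert=1+\frac{n(n+1)(n+2)}{6}.$$
   Context: $\Omega_n=\{1,\ldots,n\}$ with its natural order. A partial transformation of $\Omega_n$ is a map $\alpha$ from a subset $\operatorname{Dom}(\alpha)\subseteq\Omega_n$ (possibly empty) into $\Omega_n$, with image $\operatorname{Im}(\alpha)$. Maps are written on the right and composed from left to right: $x(\alpha\beta)=(x\alpha)\beta$, with $\operatorname{Dom}(\alpha\beta)=\{x\in\operatorname{Dom}(\alpha)\mid x\alpha\in\operatorname{Dom}(\beta)\}$. $\alpha$ is order-preserving if $x\leqslant y$ implies $x\alpha\leqslant y\alpha$ for all $x,y\in\operatorname{Dom}(\alpha)$, and order-decreasing if $x\alpha\leqslant x$ for all $x\in\operatorname{Dom}(\alpha)$. A subset $I\subseteq\Omega_n$ (possibly empty) is an interval if for all $x,y,z\in\Omega_n$, $x\leqslant y\leqslant z$ and $x,z\in I$ imply $y\in I$. $\mathcal{PIO}_n$ is the monoid, under composition, of all order-preserving partial transformations $\alpha$ of $\Omega_n$ such that $\operatorname{Dom}(\alpha)$ and $\operatorname{Im}(\alpha)$ are both intervals of $\Omega_n$ (it includes the empty transformation), and $\mathcal{PIO}_n^-$ is its submonoid of order-decreasing elements. An element $\alpha$ is idempotent if $\alpha^2=\alpha$. *)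

theory Defs
  imports Complex_Main "HOL-Algebra.Group"
begin

definition Omega :: "nat \<Rightarrow> nat set" where
  "Omega n = {1..n}"

(* The domain of a partial map is dom \<alpha> and its image is ran \<alpha>. *)
definition partial_transformation :: "nat \<Rightarrow> (nat \<rightharpoonup> nat) \<Rightarrow> bool" where
  "partial_transformation n \<alpha> \<longleftrightarrow> dom \<alpha> \<subseteq> Omega n \<and> ran \<alpha> \<subseteq> Omega n"

definition order_preserving :: "(nat \<rightharpoonup> nat) \<Rightarrow> bool" where
  "order_preserving \<alpha> \<longleftrightarrow>
    (\<forall>x\<in>dom \<alpha>. \<forall>y\<in>dom \<alpha>. x \<le> y \<longrightarrow> the (\<alpha> x) \<le> the (\<alpha> y))"

definition order_decreasing :: "(nat \<rightharpoonup> nat) \<Rightarrow> bool" where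
  "order_decreasing \<alpha> \<longleftrightarrow> (\<forall>x\<in>dom \<alpha>. the (\<alpha> x) \<le> x)"

definition interval_of :: "nat \<Rightarrow> nat set \<Rightarrow> bool" where
  "interval_of n I \<longleftrightarrow> I \<subseteq> Omega n \<and>
    (\<forall>x\<in>Omega n. \<forall>y\<in>Omega n. \<forall>z\<in>Omega n.
      x \<le> y \<and> y \<le> z \<and> x \<in> I \<and> z \<in> I \<longrightarrow> y \<in> I)"

(* Products are composed from left to right, whereas f \<circ>\<^sub>m g applies g first. *)
definition PIO :: "nat \<Rightarrow> (nat \<rightharpoonup> nat) monoid" where
  "PIO n = \<lparr>carrier = {\<alpha>. partial_transformation n \<alpha> \<and> order_preserving \<alpha> \<and>
                      interval_of n (dom \<alpha>) \<and> interval_of n (ran \<alpha>)},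
            mult = (\<lambda>\<alpha> \<beta>. \<beta> \<circ>\<^sub>m \<alpha>),
            one = Some |` Omega n\<rparr>"

definition PIO_minus :: "nat \<Rightarrow> (nat \<rightharpoonup> nat) monoid" where
  "PIO_minus n = (PIO n)\<lparr>carrier := {\<alpha> \<in> carrier (PIO n). order_decreasing \<alpha>}\<rparr>"

definition idempotents :: "('a, 'b) monoid_scheme \<Rightarrow> 'a set" where
  "idempotents M = {e \<in> carrier M. e \<otimes>\<^bsub>M\<^esub> e = e}"

lemma PIO_mult_closed:
  assumes "\<alpha> \<in> carrier (PIO n)" "\<beta> \<in> carrier (PIO n)"
  shows "\<beta> \<circ>\<^sub>m \<alpha> \<in> carrier (PIO n)"
proof -
  have dA: "dom \<alpha> \<subseteq> Omega n" and rA: "ran \<alpha> \<subseteq> Omega n"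
    and dB: "dom \<beta> \<subseteq> Omega n" and rB: "ran \<beta> \<subseteq> Omega n"
    using assms by (auto simp: PIO_def partial_transformation_def)
  have mA: "a \<le> b" if "\<alpha> x = Some a" "\<alpha> y = Some b" "x \<le> y" for x y a b
    using that assms(1) by (force simp: PIO_def order_preserving_def)
  have mB: "a \<le> b" if "\<beta> x = Some a" "\<beta> y = Some b" "x \<le> y" for x y a b
    using that assms(2) by (force simp: PIO_def order_preserving_def)
  have iv: "y \<in> I" if "interval_of n I" "x \<in> I" "z \<in> I" "x \<le> y" "y \<le> z" for I x y z
  proof -
    have sub: "I \<subseteq> Omega n" using that(1) by (simp add: interval_of_def)
    then have "1 \<le> x" "z \<le> n" using that(2,3) by (auto simp: Omega_def)
    then have "y \<in> Omega n" using that(4,5) by (simp add: Omega_def)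
    moreover have "x \<in> Omega n" "z \<in> Omega n" using sub that(2,3) by blast+
    moreover have "\<forall>x\<in>Omega n. \<forall>y\<in>Omega n. \<forall>z\<in>Omega n.
        x \<le> y \<and> y \<le> z \<and> x \<in> I \<and> z \<in> I \<longrightarrow> y \<in> I"
      using that(1) unfolding interval_of_def by (rule conjunct2)
    ultimately show ?thesis using that(2-5) by blast
  qed
  have idA: "interval_of n (dom \<alpha>)" and irA: "interval_of n (ran \<alpha>)"
    and idB: "interval_of n (dom \<beta>)" and irB: "interval_of n (ran \<beta>)"
    using assms by (auto simp: PIO_def)
  have domI: "interval_of n (dom (\<beta> \<circ>\<^sub>m \<alpha>))"
    unfolding interval_of_def
  proof (intro conjI ballI impI)
    have "dom (\<beta> \<circ>\<^sub>m \<alpha>) \<subseteq> dom \<alpha>" by (auto simp: map_comp_Some_iff)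
    then show "dom (\<beta> \<circ>\<^sub>m \<alpha>) \<subseteq> Omega n" using dA by (rule subset_trans)
  next
    fix x y z assume h: "x \<le> y \<and> y \<le> z \<and> x \<in> dom (\<beta> \<circ>\<^sub>m \<alpha>) \<and> z \<in> dom (\<beta> \<circ>\<^sub>m \<alpha>)"
    then obtain a a' c c' where e: "\<alpha> x = Some a" "\<beta> a = Some a'" "\<alpha> z = Some c" "\<beta> c = Some c'"
      by (auto simp: map_comp_Some_iff)
    have "y \<in> dom \<alpha>" using iv[OF idA, of x z y] e h by auto
    then obtain b where b: "\<alpha> y = Some b" by auto
    have "b \<in> dom \<beta>" using iv[OF idB, of a c b] e b h mA by blast
    then show "y \<in> dom (\<beta> \<circ>\<^sub>m \<alpha>)" using b by (auto simp: map_comp_Some_iff)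
  qed
  have ranI: "interval_of n (ran (\<beta> \<circ>\<^sub>m \<alpha>))"
    unfolding interval_of_def
  proof (intro conjI ballI impI)
    have "ran (\<beta> \<circ>\<^sub>m \<alpha>) \<subseteq> ran \<beta>" by (auto simp: map_comp_Some_iff ran_def)
    then show "ran (\<beta> \<circ>\<^sub>m \<alpha>) \<subseteq> Omega n" using rB by (rule subset_trans)
  next
    fix x y z assume h: "x \<le> y \<and> y \<le> z \<and> x \<in> ran (\<beta> \<circ>\<^sub>m \<alpha>) \<and> z \<in> ran (\<beta> \<circ>\<^sub>m \<alpha>)"
    then obtain p a q c where e: "\<alpha> p = Some a" "\<beta> a = Some x" "\<alpha> q = Some c" "\<beta> c = Some z"
      by (auto simp: map_comp_Some_iff ran_def)
    show "y \<in> ran (\<beta> \<circ>\<^sub>m \<alpha>)"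
    proof (cases "y = x \<or> y = z")
      case True then show ?thesis using h by auto
    next
      case False
      have "y \<in> ran \<beta>" using iv[OF irB, of x z y] e h by (auto simp: ran_def)
      then obtain b where b: "\<beta> b = Some y" by (auto simp: ran_def)
      have "a \<le> b" using mB[OF b e(2)] False h by (metis le_antisym nat_le_linear)
      moreover have "b \<le> c" using mB[OF e(4) b] False h by (metis le_antisym nat_le_linear)
      ultimately have "b \<in> ran \<alpha>" using iv[OF irA, of a c b] e by (auto simp: ran_def)
      then show ?thesis using b by (auto simp: map_comp_Some_iff ran_def)
    qed
  qed
  have "order_preserving (\<beta> \<circ>\<^sub>m \<alpha>)"
    unfolding order_preserving_def
  proof (intro ballI impI)
    fix x y assume "x \<in> dom (\<beta> \<circ>\<^sub>m \<alpha>)" "y \<in> dom (\<beta> \<circ>\<^sub>m \<alpha>)" and le: "x \<le> y"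
    then obtain a a' b b' where
      "\<alpha> x = Some a" "\<beta> a = Some a'" "\<alpha> y = Some b" "\<beta> b = Some b'"
      by (auto simp: map_comp_Some_iff)
    then show "the ((\<beta> \<circ>\<^sub>m \<alpha>) x) \<le> the ((\<beta> \<circ>\<^sub>m \<alpha>) y)" using mA mB le by fastforce
  qed
  moreover have "partial_transformation n (\<beta> \<circ>\<^sub>m \<alpha>)"
    using conjunct1[OF domI[unfolded interval_of_def]] conjunct1[OF ranI[unfolded interval_of_def]]
    unfolding partial_transformation_def by (rule conjI)
  ultimately show ?thesis using domI ranI by (simp add: PIO_def)
qed

lemma PIO_one_closed: "Some |` Omega n \<in> carrier (PIO n)"
proof -
  have "dom (Some |` Omega n) = Omega n" "ran (Some |` Omega n) = Omega n"
    by (auto simp: restrict_map_def ran_def dom_def)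
  then show ?thesis
    by (auto simp: PIO_def partial_transformation_def order_preserving_def interval_of_def)
qed

lemma monoid_PIO: "monoid (PIO n)"
proof (rule monoidI)
  fix \<alpha> assume a: "\<alpha> \<in> carrier (PIO n)"
  then have d: "dom \<alpha> \<subseteq> Omega n" and r: "ran \<alpha> \<subseteq> Omega n"
    by (auto simp: PIO_def partial_transformation_def)
  show "\<one>\<^bsub>PIO n\<^esub> \<otimes>\<^bsub>PIO n\<^esub> \<alpha> = \<alpha>"
  proof
    fix x
    show "(\<one>\<^bsub>PIO n\<^esub> \<otimes>\<^bsub>PIO n\<^esub> \<alpha>) x = \<alpha> x"
      using d by (cases "\<alpha> x") (auto simp: PIO_def map_comp_def restrict_map_def)
  qed
  have "\<alpha> x = Some y \<Longrightarrow> y \<in> Omega n" for x y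
    using r by (auto simp: ran_def)
  then show "\<alpha> \<otimes>\<^bsub>PIO n\<^esub> \<one>\<^bsub>PIO n\<^esub> = \<alpha>"
    by (auto simp: PIO_def map_comp_def restrict_map_def fun_eq_iff split: option.split)
next
  fix \<alpha> \<beta> \<gamma>
  show "\<alpha> \<otimes>\<^bsub>PIO n\<^esub> \<beta> \<otimes>\<^bsub>PIO n\<^esub> \<gamma> = \<alpha> \<otimes>\<^bsub>PIO n\<^esub> (\<beta> \<otimes>\<^bsub>PIO n\<^esub> \<gamma>)"
    by (auto simp: PIO_def map_comp_def fun_eq_iff split: option.split)
qed (use PIO_mult_closed PIO_one_closed in \<open>auto simp: PIO_def\<close>)

lemma submonoid_PIO_minus: "submonoid (carrier (PIO_minus n)) (PIO n)"
proof
  show "carrier (PIO_minus n) \<subseteq> carrier (PIO n)" by (auto simp: PIO_minus_def)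
next
  fix \<alpha> \<beta> assume "\<alpha> \<in> carrier (PIO_minus n)" "\<beta> \<in> carrier (PIO_minus n)"
  then have c: "\<alpha> \<in> carrier (PIO n)" "\<beta> \<in> carrier (PIO n)"
    and o: "order_decreasing \<alpha>" "order_decreasing \<beta>" by (auto simp: PIO_minus_def)
  have "order_decreasing (\<beta> \<circ>\<^sub>m \<alpha>)"
    unfolding order_decreasing_def
  proof
    fix x assume "x \<in> dom (\<beta> \<circ>\<^sub>m \<alpha>)"
    then obtain a b where e: "\<alpha> x = Some a" "\<beta> a = Some b"
      by (auto simp: map_comp_Some_iff)
    have "a \<le> x"
      using bspec[OF o(1)[unfolded order_decreasing_def] domI[of \<alpha> x a, OF e(1)]] e(1) by simp
    moreover have "b \<le> a"
      using bspec[OF o(2)[unfolded order_decreasing_def] domI[of \<beta> a b, OF e(2)]] e(2) by simp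
    ultimately show "the ((\<beta> \<circ>\<^sub>m \<alpha>) x) \<le> x" using e by simp
  qed
  then have "\<beta> \<circ>\<^sub>m \<alpha> \<in> carrier (PIO_minus n)"
    using PIO_mult_closed[OF c] by (simp add: PIO_minus_def)
  moreover have "\<alpha> \<otimes>\<^bsub>PIO n\<^esub> \<beta> = \<beta> \<circ>\<^sub>m \<alpha>" by (simp add: PIO_def)
  ultimately show "\<alpha> \<otimes>\<^bsub>PIO n\<^esub> \<beta> \<in> carrier (PIO_minus n)" by simp
next
  have "\<one>\<^bsub>PIO n\<^esub> = Some |` Omega n" by (simp add: PIO_def)
  moreover have "order_decreasing (Some |` Omega n)"
    by (auto simp: order_decreasing_def restrict_map_def)
  ultimately show "\<one>\<^bsub>PIO n\<^esub> \<in> carrier (PIO_minus n)"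
    using PIO_one_closed by (simp add: PIO_minus_def)
qed

end

theory Submission
  imports Defs
begin

text \<open>
  An idempotent fixes its image pointwise, and the image lies in the domain. If the domain is a
  nonempty interval \<open>{a..c}\<close>, a decreasing idempotent must also fix \<open>a\<close>, since \<open>a\<close> is sent to a
  point of the domain that is at most \<open>a\<close>. The image is therefore an interval \<open>{a..b}\<close> with
  \<open>a \<le> b \<le> c\<close>: the points up to \<open>b\<close> are fixed, and monotonicity squeezes the points above
  \<open>b\<close> onto \<open>b\<close>. So the nonempty idempotents are exactly the maps \<open>x \<mapsto> min x b\<close> on \<open>{a..c}\<close>
  (\<open>idempotents_PIO_minus\<close>). Distinct triples \<open>1 \<le> a \<le> b \<le> c \<le> n\<close> give distinct maps, so
  these are counted by the multisets of size three in an \<open>n\<close>-element set, and the empty map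
  contributes the remaining idempotent.
\<close>

definition truncation :: "nat \<Rightarrow> nat \<Rightarrow> nat \<Rightarrow> nat \<rightharpoonup> nat" where
  "truncation a b c = (\<lambda>x. if a \<le> x \<and> x \<le> c then Some (min x b) else None)"

text \<open>The order is \<open>(c, b, a)\<close>, so that the range of each coordinate depends only on the one
  before it and the cardinality is an iterated sum.\<close>

definition chains :: "nat \<Rightarrow> (nat \<times> nat \<times> nat) set" where
  "chains n = (SIGMA c:{1..n}. SIGMA b:{1..c}. {1..b})"

lemma mem_chains: "(c, b, a) \<in> chains n \<longleftrightarrow> 1 \<le> a \<and> a \<le> b \<and> b \<le> c \<and> c \<le> n"
  by (auto simp: chains_def)

lemma finite_chains: "finite (chains n)"
  by (simp add: chains_def)

lemma card_chains: "real (card (chains n)) = real n * (real n + 1) * (real n + 2) / 6"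
proof -
  have gauss: "real (\<Sum>b=1..c. b) = real c * (real c + 1) / 2" for c
    by (induction c) (auto simp: field_simps)
  have "real (card (chains n)) = (\<Sum>c=1..n. real (\<Sum>b=1..c. b))"
    by (simp add: chains_def)
  also have "\<dots> = (\<Sum>c=1..n. real c * (real c + 1) / 2)"
    by (simp only: gauss)
  also have "\<dots> = real n * (real n + 1) * (real n + 2) / 6"
    by (induction n) (auto simp: field_simps)
  finally show ?thesis .
qed

lemma interval_of_atLeastAtMost: "1 \<le> a \<Longrightarrow> c \<le> n \<Longrightarrow> interval_of n {a..c}"
  by (auto simp: interval_of_def Omega_def)

lemma interval_of_eq_atLeastAtMost:
  assumes "interval_of n I" "I \<noteq> {}"
  obtains a c where "1 \<le> a" "a \<le> c" "c \<le> n" "I = {a..c}"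
proof -
  have sub: "I \<subseteq> {1..n}"
    using assms(1) by (simp add: interval_of_def Omega_def)
  then have fin: "finite I"
    by (rule finite_subset) simp
  have ends: "Min I \<in> I" "Max I \<in> I"
    using fin assms(2) by auto
  have "y \<in> I" if "y \<in> {Min I..Max I}" for y
  proof -
    have "y \<in> Omega n" "Min I \<in> Omega n" "Max I \<in> Omega n"
      using ends sub that by (auto simp: Omega_def)
    moreover have "Min I \<le> y" "y \<le> Max I"
      using that by auto
    ultimately show ?thesis
      using assms(1) ends unfolding interval_of_def by blast
  qed
  then have "{Min I..Max I} \<subseteq> I"
    by blast
  moreover have "I \<subseteq> {Min I..Max I}"
    using fin by (simp add: subset_iff)
  ultimately have "I = {Min I..Max I}"
    by (rule equalityI[rotated])
  moreover have "1 \<le> Min I" "Min I \<le> Max I" "Max I \<le> n"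
    using ends sub fin by auto
  ultimately show ?thesis
    using that by blast
qed

lemma dom_truncation: "dom (truncation a b c) = {a..c}"
  by (auto simp: truncation_def dom_def)

lemma ran_truncation:
  assumes "a \<le> b" "b \<le> c"
  shows "ran (truncation a b c) = {a..b}"
proof
  show "ran (truncation a b c) \<subseteq> {a..b}"
    using assms by (auto simp: truncation_def ran_def split: if_splits)
  show "{a..b} \<subseteq> ran (truncation a b c)"
  proof
    fix y assume "y \<in> {a..b}"
    then have "truncation a b c y = Some y"
      using assms by (auto simp: truncation_def)
    then show "y \<in> ran (truncation a b c)"
      by (rule ranI)
  qed
qed

lemma truncation_eq_iff:
  assumes "a \<le> b" "b \<le> c" "a' \<le> b'" "b' \<le> c'"
  shows "truncation a b c = truncation a' b' c' \<longleftrightarrow> a = a' \<and> b = b' \<and> c = c'"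
proof
  assume eq: "truncation a b c = truncation a' b' c'"
  have "{a..c} = {a'..c'}" "{a..b} = {a'..b'}"
    using arg_cong[OF eq, of dom] arg_cong[OF eq, of ran] assms
    by (simp_all add: dom_truncation ran_truncation)
  then show "a = a' \<and> b = b' \<and> c = c'"
    using assms by (simp add: Icc_eq_Icc)
qed simp

lemma idempotents_PIO_minus_iff:
  "\<alpha> \<in> idempotents (PIO_minus n) \<longleftrightarrow>
    partial_transformation n \<alpha> \<and> order_preserving \<alpha> \<and> order_decreasing \<alpha> \<and>
    interval_of n (dom \<alpha>) \<and> interval_of n (ran \<alpha>) \<and> \<alpha> \<circ>\<^sub>m \<alpha> = \<alpha>"
  by (auto simp: idempotents_def PIO_minus_def PIO_def)

text \<open>Turns the equation between composites into a pointwise condition on the image, which is how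
  idempotency is used in both directions of the classification.\<close>

lemma map_comp_idem_iff: "\<alpha> \<circ>\<^sub>m \<alpha> = \<alpha> \<longleftrightarrow> (\<forall>y\<in>ran \<alpha>. \<alpha> y = Some y)"
proof
  assume idem: "\<alpha> \<circ>\<^sub>m \<alpha> = \<alpha>"
  show "\<forall>y\<in>ran \<alpha>. \<alpha> y = Some y"
  proof
    fix y assume "y \<in> ran \<alpha>"
    then obtain x where "\<alpha> x = Some y"
      by (auto simp: ran_def)
    then show "\<alpha> y = Some y"
      using fun_cong[OF idem, of x] by simp
  qed
next
  assume fixed: "\<forall>y\<in>ran \<alpha>. \<alpha> y = Some y"
  show "\<alpha> \<circ>\<^sub>m \<alpha> = \<alpha>"
  proof
    fix x
    show "(\<alpha> \<circ>\<^sub>m \<alpha>) x = \<alpha> x"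
    proof (cases "\<alpha> x")
      case (Some y)
      then have "\<alpha> y = Some y"
        using fixed by (blast intro: ranI)
      then show ?thesis
        using Some by simp
    qed simp
  qed
qed

lemma truncation_idempotent:
  assumes "1 \<le> a" "a \<le> b" "b \<le> c" "c \<le> n"
  shows "truncation a b c \<in> idempotents (PIO_minus n)"
proof -
  have "order_preserving (truncation a b c)" "order_decreasing (truncation a b c)"
    by (auto simp: order_preserving_def order_decreasing_def dom_truncation)
       (auto simp: truncation_def)
  moreover have "truncation a b c \<circ>\<^sub>m truncation a b c = truncation a b c"
    using assms by (simp add: map_comp_idem_iff ran_truncation) (simp add: truncation_def)
  ultimately show ?thesis
    using assms
    by (auto simp: idempotents_PIO_minus_iff partial_transformation_def Omega_def
        dom_truncation ran_truncation interval_of_atLeastAtMost)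
qed

lemma empty_idempotent: "Map.empty \<in> idempotents (PIO_minus n)"
  by (auto simp: idempotents_PIO_minus_iff partial_transformation_def order_preserving_def
      order_decreasing_def interval_of_def)

text \<open>The image is contained in the domain because its points are fixed, and decreasingness forces
  both intervals to start at the same point. The greatest element of the image is then the
  threshold of the truncation.\<close>

lemma idempotent_is_truncation:
  assumes "\<alpha> \<in> idempotents (PIO_minus n)" "\<alpha> \<noteq> Map.empty"
  obtains a b c where "1 \<le> a" "a \<le> b" "b \<le> c" "c \<le> n" "\<alpha> = truncation a b c"
proof -
  have "order_preserving \<alpha>" "order_decreasing \<alpha>"
    using assms(1) by (simp_all add: idempotents_PIO_minus_iff)
  then have mono: "\<And>x y u v. \<alpha> x = Some u \<Longrightarrow> \<alpha> y = Some v \<Longrightarrow> x \<le> y \<Longrightarrow> u \<le> v"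
    and decr: "\<And>x u. \<alpha> x = Some u \<Longrightarrow> u \<le> x"
    unfolding order_preserving_def order_decreasing_def by (metis domI option.sel)+
  have fix_ran: "\<alpha> y = Some y" if "y \<in> ran \<alpha>" for y
    using assms(1) that by (simp add: idempotents_PIO_minus_iff map_comp_idem_iff)
  have intervals: "interval_of n (dom \<alpha>)" "interval_of n (ran \<alpha>)"
    using assms(1) by (simp_all add: idempotents_PIO_minus_iff)
  have nonempty: "dom \<alpha> \<noteq> {}" "ran \<alpha> \<noteq> {}"
    using assms(2) by (auto simp: ran_def fun_eq_iff)
  obtain a c where ac: "1 \<le> a" "a \<le> c" "c \<le> n" "dom \<alpha> = {a..c}"
    using interval_of_eq_atLeastAtMost[OF intervals(1) nonempty(1)] .
  obtain i b where ib: "1 \<le> i" "i \<le> b" "b \<le> n" "ran \<alpha> = {i..b}"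
    using interval_of_eq_atLeastAtMost[OF intervals(2) nonempty(2)] .
  have "ran \<alpha> \<subseteq> dom \<alpha>"
    using fix_ran by blast
  then have "a \<le> i" "b \<le> c"
    using ac(4) ib by auto
  \<comment> \<open>The value at the least point of the domain lies in the image and, by decreasingness, not
    above that point.\<close>
  moreover have "i \<le> a"
  proof -
    obtain u where u: "\<alpha> a = Some u"
      using ac(2,4) by (metis atLeastAtMost_iff domD order_refl)
    then have "u \<in> {i..b}"
      using ib(4) by (metis ranI)
    then show ?thesis
      using decr[OF u] by simp
  qed
  ultimately have ran: "ran \<alpha> = {a..b}" "a \<le> b" "b \<le> c"
    using ib by auto
  have "\<alpha> x = truncation a b c x" for x
  proof (cases "x \<in> dom \<alpha>")
    case False
    then have "\<not> (a \<le> x \<and> x \<le> c)"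
      using ac(4) by auto
    then show ?thesis
      using False by (auto simp: truncation_def domIff)
  next
    case True
    then obtain u where u: "\<alpha> x = Some u"
      by blast
    have x: "a \<le> x" "x \<le> c"
      using True ac(4) by auto
    have "u = min x b"
    proof (cases "x \<le> b")
      case True
      then show ?thesis
        using fix_ran[of x] ran x u by simp
    next
      case False
      \<comment> \<open>\<open>b\<close> is the greatest value and is attained at \<open>b < x\<close>, so monotonicity leaves only
        \<open>b\<close> for the value at \<open>x\<close>.\<close>
      have "\<alpha> b = Some b"
        using fix_ran[of b] ran by simp
      then have "b \<le> u"
        using mono[OF _ u] False by simp
      moreover have "u \<le> b"
        using ranI[of \<alpha> x u, OF u] ran(1) by simp
      ultimately show ?thesis
        using False by simp
    qed
    then show ?thesis
      using u x by (simp add: truncation_def)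
  qed
  then have "\<alpha> = truncation a b c"
    by blast
  then show ?thesis
    using that ac ran by blast
qed

lemma idempotents_PIO_minus:
  "idempotents (PIO_minus n) =
    insert Map.empty ((\<lambda>(c, b, a). truncation a b c) ` chains n)"
proof
  show "idempotents (PIO_minus n) \<subseteq>
      insert Map.empty ((\<lambda>(c, b, a). truncation a b c) ` chains n)"
  proof
    fix \<alpha> assume mem: "\<alpha> \<in> idempotents (PIO_minus n)"
    show "\<alpha> \<in> insert Map.empty ((\<lambda>(c, b, a). truncation a b c) ` chains n)"
    proof (cases "\<alpha> = Map.empty")
      case False
      with mem obtain a b c where "1 \<le> a" "a \<le> b" "b \<le> c" "c \<le> n" "\<alpha> = truncation a b c"
        by (rule idempotent_is_truncation)
      then have "(c, b, a) \<in> chains n" "\<alpha> = (\<lambda>(c, b, a). truncation a b c) (c, b, a)"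
        by (simp_all add: mem_chains)
      then show ?thesis
        by blast
    qed simp
  qed
  show "insert Map.empty ((\<lambda>(c, b, a). truncation a b c) ` chains n) \<subseteq>
      idempotents (PIO_minus n)"
    by (auto simp: mem_chains empty_idempotent truncation_idempotent)
qed

theorem proposition13:
  fixes n :: nat
  assumes "n \<ge> 1"
  shows "real (card (idempotents (PIO_minus n))) =
    1 + real n * (real n + 1) * (real n + 2) / 6"
proof -
  let ?f = "\<lambda>(c, b, a). truncation a b c"
  have "inj_on ?f (chains n)"
    by (auto simp: inj_on_def mem_chains truncation_eq_iff)
  then have "card (?f ` chains n) = card (chains n)"
    by (rule card_image)
  moreover have "Map.empty \<notin> ?f ` chains n"
  proof
    assume "Map.empty \<in> ?f ` chains n"
    then obtain a b c where "a \<le> b" "b \<le> c" "Map.empty = truncation a b c"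
      by (auto simp: mem_chains)
    then have "{a..c} = {}"
      using dom_truncation[of a b c] by (metis dom_empty)
    then show False
      using \<open>a \<le> b\<close> \<open>b \<le> c\<close> by simp
  qed
  ultimately have "card (idempotents (PIO_minus n)) = Suc (card (chains n))"
    by (simp add: idempotents_PIO_minus finite_chains)
  then show ?thesis
    by (simp add: card_chains)
qed

end
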